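(* Let $h$ and $F$ be as in the context, and suppose: $\nabla F$ is $L_{\nabla F}$-Lipschitz; $h$ is $(\mu,L)$-regular (nonsmooth sense) for $F$ with unique minimizer $z^\star$ over $\operatorname{Im}F$; and $F$ is weakly aligned at $z^\star$ with functions $\delta,s$. Let $x_0\in\mathbf{E}$ be such that $z_0=F(x_0)$ satisfies $\|z_0-z^\star\|\le \delta\left(\frac{\mu}{8L}\right)$. Then the following two statements hold. 1. (Polyak stepsize) Suppose $(x_k)_{k\ge0}$ is generated by the LMM subgradient method started at $x_0$ with the Polyak configuration with parameters $\gamma, C_{\mathtt{lb}}, C_{\mathtt{ub}}$, where $\gamma\le\min\left\{1,\frac{C_{\mathtt{lb}}}{L_{\nabla F}}\right\}$ and $C_{\mathtt{ub}}\le\frac{\mu}{8L}\,s\left(\frac{\mu}{8L}\right)$. Then $z_k=F(x_k)$ satisfies $$\|z_k-z^\star\|\le\left(1-\frac{\gamma\mu^2}{8L^2}\right)^{k/2}\|z_0-z^\star\|\quad\text{for all }k\ge0.$$ 2. (Geometrically decaying stepsize) Let $M=\delta\left(\frac{\mu}{8L}\right)$. Suppose $(x_k)_{k\ge0}$ is generated by the LMM subgradient method started at $x_0$ with $\gamma_k=\gamma q^k$, $\lambda_k=\lambda q^k$, where $\gamma,\lambda>0$, $q\in(0,1)$ satisfy $$\lambda\le\frac{M\,s\left(\frac{\mu}{8L}\right)}{128}\frac{\mu}{L},\qquad \gamma\le\frac1L\min\left\{\frac{M\mu}{64L},\sqrt{\frac{2\lambda M}{L_{\nabla F}}},\frac{\lambda\mu}{2L_{\nabla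 F}L}\right\},\qquad q\ge\max\left\{1-\frac{\gamma\mu}{4M},\frac1{\sqrt2}\right\}.$$ Then $z_k=F(x_k)$ satisfies $\|z_k-z^\star\|\le Mq^k$ for all $k\ge0$.
   Context: Setting. $\mathbf{E},\mathbf{Y}$ are finite-dimensional Euclidean spaces with inner products $\langle\cdot,\cdot\rangle$ and induced norms $\|\cdot\|$; $h:\mathbf{Y}\to\mathbb{R}$ is convex and $F:\mathbf{E}\to\mathbf{Y}$ is continuously differentiable. $\nabla F(x):\mathbf{E}\to\mathbf{Y}$ is the derivative (Jacobian) and $\nabla F(x)^\top$ its adjoint. $\partial h$ is the convex subdifferential. $\mathbb{R}_+$ denotes the positive reals, $B_r(z)$ the closed ball of radius $r$, and $1/0=+\infty$. $h^\star$ and $\mathcal{Z}^\star$ are the minimum value and the set of minimizers of $h$ over $\operatorname{Im}F$. $\Pi^x$ is the orthogonal projection onto the range of $\nabla F(x)$. Fix for each $x$ an SVD of $\nabla F(x)$ with singular values $\sigma^x_1\ge\sigma^x_2\ge\cdots$; $\Pi^x_j$ is the orthogonal projection onto the span of the top $j$ left singular vectors. For $\lambda>0$, $P(x,\lambda)=\nabla F(x)(\nabla F(x)^\top\nabla F(x)+\lambda I)^{-1}\nabla F(x)^\top$. LMM (Levenberg-Morrison-Marquardt) subgradient method. Given $x_0\in\mathbf{E}$, stepsizes $\gamma_k>0$ and damping coefficients $\lambda_k>0$: for $k\ge0$ pick any $v_k\in\partial h(F(x_k))$ and set $x_{k+1}=x_k-\gamma_k(\nabla F(x_k)^\top\nabla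 F(x_k)+\lambda_kI)^{-1}\nabla F(x_k)^\top v_k$. Write $z_k=F(x_k)$. Polyak configuration with parameters $\gamma>0$, $0<C_{\mathtt{lb}}\le C_{\mathtt{ub}}$: $\gamma_k=\gamma\frac{h(z_k)-h^\star}{\|\Pi^{x_k}v_k\|^2}$ and $C_{\mathtt{lb}}\operatorname{dist}(z_k,\mathcal{Z}^\star)\le\lambda_k\le C_{\mathtt{ub}}\operatorname{dist}(z_k,\mathcal{Z}^\star)$ for all $k$. $\nabla F$ is $L_{\nabla F}$-Lipschitz ($L_{\nabla F}\ge0$): $\|\nabla F(x)-\nabla F(y)\|_{\mathrm{op}}\le L_{\nabla F}\|x-y\|$ for all $x,y\in\mathbf{E}$. $F$ is weakly aligned at $z^\star\in\operatorname{Im}F$ with functions $\delta,s:\mathbb{R}_+\to\mathbb{R}_+$: for any $\rho>0$ and any $z=F(x)\in B_{\delta(\rho)}(z^\star)$ there is an index $j$ with $\|(I-\Pi^x_j)(z-z^\star)\|\le\rho\|z-z^\star\|$ and $(\sigma^x_j)^2\ge s(\rho)\|z-z^\star\|$. $h$ is $(\mu,L)$-regular (nonsmooth sense) for $F$ ($\mu,L>0$): (1) $h$ has a unique minimizer $z^\star$ over $\operatorname{Im}F$; (2) $h$ is convex; (3) $h(z)-h^\star\ge\mu\|z-z^\star\|$ for all $z\in\operatorname{Im}F$; (4a) $\|\Pi^xv\|\le L$ for all $x\in\mathbf{E}$ and $v\in\partial h(F(x))$; (4b) for all $x\in\mathbf{E}$, $z=F(x)$, $v\in\partial h(F(x))$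 and $\lambda>0$, $|\langle v,(I-P(x,\lambda))(z-z^\star)\rangle|\le L\|(I-P(x,\lambda))(z-z^\star)\|$. *)

theory Defs
  imports "HOL-Analysis.Analysis"
begin

definition subdifferential :: "('y::real_inner \<Rightarrow> real) \<Rightarrow> 'y \<Rightarrow> 'y set" where
  "subdifferential h z = {v. \<forall>y. h y \<ge> h z + v \<bullet> (y - z)}"

definition orth_proj :: "'y::real_inner set \<Rightarrow> 'y \<Rightarrow> 'y" where
  "orth_proj S v = (THE p. p \<in> S \<and> (\<forall>w\<in>S. orthogonal (v - p) w))"

lemma orth_proj_unique:
  fixes S :: "'y::real_inner set"
  assumes "subspace S" "p \<in> S" "\<And>w. w \<in> S \<Longrightarrow> orthogonal (v - p) w"
  shows "orth_proj S v = p"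
  unfolding orth_proj_def
proof (rule the_equality)
  fix p' assume p': "p' \<in> S \<and> (\<forall>w\<in>S. orthogonal (v - p') w)"
  then have "p - p' \<in> S" using assms by (simp add: subspace_diff)
  then have "(v - p') \<bullet> (p - p') = 0" "(v - p) \<bullet> (p - p') = 0"
    using p' assms(3) by (auto simp: orthogonal_def)
  then have "(p - p') \<bullet> (p - p') = 0" by (simp add: inner_diff_left)
  then show "p' = p" by simp
qed (use assms in auto)

text \<open>A Euclidean space type has positive dimension, so the index range of the singular
  values is never empty. \<open>\<sigma>\<close>, \<open>U\<close>, \<open>V\<close> are meaningful only on the index ranges below,
  starting at 1.\<close>

definition orthonormal_on :: "nat set \<Rightarrow> (nat \<Rightarrow> 'a::real_inner) \<Rightarrow> bool" where
  "orthonormal_on J U \<longleftrightarrow> (\<forall>i\<in>J. \<forall>j\<in>J. U i \<bullet> U j = (if i = j then 1 else 0))"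

definition is_svd ::
  "('e::euclidean_space \<Rightarrow>\<^sub>L 'y::euclidean_space) \<Rightarrow> (nat \<Rightarrow> real) \<Rightarrow> (nat \<Rightarrow> 'y) \<Rightarrow> (nat \<Rightarrow> 'e) \<Rightarrow> bool"
where
  "is_svd A \<sigma> U V \<longleftrightarrow>
     orthonormal_on {1..DIM('y)} U \<and> orthonormal_on {1..DIM('e)} V \<and>
     (\<forall>i\<in>{1..min DIM('e) DIM('y)}. \<sigma> i \<ge> 0) \<and>
     (\<forall>i\<in>{1..min DIM('e) DIM('y)}. \<forall>j\<in>{1..min DIM('e) DIM('y)}. i \<le> j \<longrightarrow> \<sigma> j \<le> \<sigma> i) \<and>
     (\<forall>d. blinfun_apply A d = (\<Sum>i = 1..min DIM('e) DIM('y). (\<sigma> i * (V i \<bullet> d)) *\<^sub>R U i))"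

definition range_proj :: "('e::euclidean_space \<Rightarrow>\<^sub>L 'y::euclidean_space) \<Rightarrow> 'y \<Rightarrow> 'y" where
  "range_proj A = orth_proj (range (blinfun_apply A))"

definition top_proj :: "(nat \<Rightarrow> 'y::euclidean_space) \<Rightarrow> nat \<Rightarrow> 'y \<Rightarrow> 'y" where
  "top_proj U j = orth_proj (span (U ` {1..j}))"

text \<open>\<open>A\<^sup>T A + \<lambda> I\<close>; it is a bijection for \<open>\<lambda> > 0\<close>, the only case in which its inverse is used.\<close>

definition damped_gram :: "('e::euclidean_space \<Rightarrow>\<^sub>L 'y::euclidean_space) \<Rightarrow> real \<Rightarrow> 'e \<Rightarrow> 'e" where
  "damped_gram A lam d = adjoint (blinfun_apply A) (blinfun_apply A d) + lam *\<^sub>R d"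

lemma bij_damped_gram:
  fixes A :: "'e::euclidean_space \<Rightarrow>\<^sub>L 'y::euclidean_space"
  assumes "lam > 0"
  shows "bij (damped_gram A lam)"
proof -
  have lA: "linear (blinfun_apply A)"
    by (intro bounded_linear.linear blinfun.bounded_linear_right)
  have "linear (\<lambda>d. adjoint (blinfun_apply A) (blinfun_apply A d) + lam *\<^sub>R d)"
    using linear_compose[OF lA adjoint_linear[OF lA]]
    by (intro linear_compose_add linear_compose_scale_right) (auto simp: o_def linear_id[unfolded id_def])
  then have lin: "linear (damped_gram A lam)" by (simp add: damped_gram_def[abs_def])
  have "d = 0" if "damped_gram A lam d = 0" for d
  proof -
    have "0 = damped_gram A lam d \<bullet> d" using that by simp
    also have "\<dots> = blinfun_apply A d \<bullet> blinfun_apply A d + lam * (d \<bullet> d)"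
      by (simp add: damped_gram_def inner_add_left adjoint_works[OF lA] adjoint_clauses(2)[OF lA])
    finally have "lam * (d \<bullet> d) \<le> 0" using inner_ge_zero[of "blinfun_apply A d"] by linarith
    with assms have "\<not> 0 < d \<bullet> d" using mult_pos_pos by (meson not_le)
    then show "d = 0" by (simp add: inner_gt_zero_iff)
  qed
  then have "inj (damped_gram A lam)" using lin linear_injective_0 by blast
  with lin show ?thesis by (simp add: bij_def linear_injective_imp_surjective)
qed

definition damped_proj :: "('e::euclidean_space \<Rightarrow>\<^sub>L 'y::euclidean_space) \<Rightarrow> real \<Rightarrow> 'y \<Rightarrow> 'y" where
  "damped_proj A lam y = blinfun_apply A (inv (damped_gram A lam) (adjoint (blinfun_apply A) y))"

definition minimizers_on :: "('y \<Rightarrow> real) \<Rightarrow> 'y set \<Rightarrow> 'y set" where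
  "minimizers_on h S = {z. is_arg_min h (\<lambda>z. z \<in> S) z}"

text \<open>The infimum is a minimum whenever it is used, because a minimizer is assumed to exist.\<close>

definition min_value :: "('y \<Rightarrow> real) \<Rightarrow> 'y set \<Rightarrow> real" where
  "min_value h S = (INF z\<in>S. h z)"

text \<open>In the next definitions \<open>DF\<close> is the derivative of \<open>F\<close>.\<close>

definition nonsmooth_regular ::
  "('y::euclidean_space \<Rightarrow> real) \<Rightarrow> ('e::euclidean_space \<Rightarrow> 'y) \<Rightarrow> ('e \<Rightarrow> 'e \<Rightarrow>\<^sub>L 'y) \<Rightarrow>
    real \<Rightarrow> real \<Rightarrow> 'y \<Rightarrow> bool"
where
  "nonsmooth_regular h F DF \<mu> L zstar \<longleftrightarrow>
     \<mu> > 0 \<and> L > 0 \<and>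
     minimizers_on h (range F) = {zstar} \<and>
     convex_on UNIV h \<and>
     (\<forall>z\<in>range F. h z - min_value h (range F) \<ge> \<mu> * norm (z - zstar)) \<and>
     (\<forall>x. \<forall>v\<in>subdifferential h (F x). norm (range_proj (DF x) v) \<le> L) \<and>
     (\<forall>x. \<forall>v\<in>subdifferential h (F x). \<forall>lam>0.
        \<bar>v \<bullet> ((F x - zstar) - damped_proj (DF x) lam (F x - zstar))\<bar>
          \<le> L * norm ((F x - zstar) - damped_proj (DF x) lam (F x - zstar)))"

text \<open>\<open>\<sigma> x\<close> and \<open>U x\<close> are the singular values and left singular vectors of the derivative
  at \<open>x\<close>.\<close>

definition weakly_aligned ::
  "('e::euclidean_space \<Rightarrow> 'y::euclidean_space) \<Rightarrow> ('e \<Rightarrow> nat \<Rightarrow> real) \<Rightarrow> ('e \<Rightarrow> nat \<Rightarrow> 'y) \<Rightarrow>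
    'y \<Rightarrow> (real \<Rightarrow> real) \<Rightarrow> (real \<Rightarrow> real) \<Rightarrow> bool"
where
  "weakly_aligned F \<sigma> U zstar \<delta> s \<longleftrightarrow>
     zstar \<in> range F \<and> (\<forall>\<rho>>0. \<delta> \<rho> > 0 \<and> s \<rho> > 0) \<and>
     (\<forall>\<rho>>0. \<forall>x. F x \<in> cball zstar (\<delta> \<rho>) \<longrightarrow>
        (\<exists>j\<in>{1..min DIM('e) DIM('y)}.
           norm ((F x - zstar) - top_proj (U x) j (F x - zstar)) \<le> \<rho> * norm (F x - zstar) \<and>
           (\<sigma> x j)\<^sup>2 \<ge> s \<rho> * norm (F x - zstar)))"

definition lmm_subgradient ::
  "('y::euclidean_space \<Rightarrow> real) \<Rightarrow> ('e::euclidean_space \<Rightarrow> 'y) \<Rightarrow> ('e \<Rightarrow> 'e \<Rightarrow>\<^sub>L 'y) \<Rightarrow> 'e \<Rightarrow>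
    (nat \<Rightarrow> real) \<Rightarrow> (nat \<Rightarrow> real) \<Rightarrow> (nat \<Rightarrow> 'y) \<Rightarrow> (nat \<Rightarrow> 'e) \<Rightarrow> bool"
where
  "lmm_subgradient h F DF x0 gam lam v x \<longleftrightarrow>
     x 0 = x0 \<and>
     (\<forall>k. gam k > 0 \<and> lam k > 0 \<and>
        v k \<in> subdifferential h (F (x k)) \<and>
        x (Suc k) = x k - gam k *\<^sub>R inv (damped_gram (DF (x k)) (lam k))
                                     (adjoint (blinfun_apply (DF (x k))) (v k)))"

definition polyak_config ::
  "('y::euclidean_space \<Rightarrow> real) \<Rightarrow> ('e::euclidean_space \<Rightarrow> 'y) \<Rightarrow> ('e \<Rightarrow> 'e \<Rightarrow>\<^sub>L 'y) \<Rightarrow>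
    real \<Rightarrow> real \<Rightarrow> real \<Rightarrow> (nat \<Rightarrow> real) \<Rightarrow> (nat \<Rightarrow> real) \<Rightarrow> (nat \<Rightarrow> 'y) \<Rightarrow> (nat \<Rightarrow> 'e) \<Rightarrow> bool"
where
  "polyak_config h F DF \<gamma> Clb Cub gam lam v x \<longleftrightarrow>
     \<gamma> > 0 \<and> 0 < Clb \<and> Clb \<le> Cub \<and>
     (\<forall>k. gam k = \<gamma> * ((h (F (x k)) - min_value h (range F))
                         / (norm (range_proj (DF (x k)) (v k)))\<^sup>2) \<and>
          Clb * infdist (F (x k)) (minimizers_on h (range F)) \<le> lam k \<and>
          lam k \<le> Cub * infdist (F (x k)) (minimizers_on h (range F)))"

text \<open>The two stepsize caps contain quotients by the Lipschitz constant \<open>LF\<close> of the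
  derivative. With the convention \<open>1/0 = \<infinity>\<close> these terms disappear from the minimum when
  \<open>LF = 0\<close>; in HOL \<open>1/0 = 0\<close>, hence the case distinction.\<close>

definition polyak_cap :: "real \<Rightarrow> real \<Rightarrow> real" where
  "polyak_cap Clb LF = (if LF = 0 then 1 else min 1 (Clb / LF))"

definition geometric_cap :: "real \<Rightarrow> real \<Rightarrow> real \<Rightarrow> real \<Rightarrow> real \<Rightarrow> real" where
  "geometric_cap \<mu> L LF M lam =
     1 / L * (if LF = 0 then M * \<mu> / (64 * L)
              else Min {M * \<mu> / (64 * L), sqrt (2 * lam * M / LF), lam * \<mu> / (2 * LF * L)})"

end

theory Submission
  imports Defs
begin

text \<open>
  Write \<open>z = F x\<close>, \<open>w = z - zstar\<close>, let \<open>A\<close> be the derivative at \<open>x\<close> and \<open>P\<close> the damped projection.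
  One step of the method moves \<open>x\<close> by \<open>- g d\<close> with \<open>(A\<^sup>T A + lam I) d = A\<^sup>T v\<close>, and \<open>A d = P v\<close>. To first
  order \<open>z\<close> therefore moves by \<open>- g P v\<close>: a subgradient step in the image space, with the
  subgradient replaced by \<open>P v\<close>. Three facts make this a good step.

  \<^item> Correlation with \<open>w\<close>. As \<open>P\<close> is symmetric, \<open>P v \<bullet> w = v \<bullet> w - v \<bullet> (w - P w)\<close>. The
    subgradient inequality bounds the first term below by the gap \<open>h z - hstar\<close>, and regularity
    bounds the second by \<open>L * norm (w - P w)\<close> (\<open>damped_direction_correlates\<close>).

  \<^item> Weak alignment makes \<open>w - P w\<close> small. On a left singular vector, \<open>I - P\<close> acts as the factor
    \<open>lam / (\<sigma>\<^sup>2 + lam)\<close>. This factor is small on the top \<open>j\<close> singular vectors as long as \<open>lam\<close> is small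
    relative to \<open>\<sigma>\<^sub>j\<^sup>2\<close>; the remaining component of \<open>w\<close> is small by alignment, and \<open>I - P\<close> is a
    contraction (\<open>residual_le_if_aligned\<close>). Together with sharpness, this leaves
    a fixed fraction of the gap in the lower bound for \<open>P v \<bullet> w\<close>.

  \<^item> The linearization error is at most \<open>LF / 2 * (g * norm d)\<^sup>2\<close>, and damping caps the step: each
    singular value contributes \<open>\<sigma> / (\<sigma>\<^sup>2 + lam) \<le> 1 / (2 sqrt lam)\<close>, so that
    \<open>(norm d)\<^sup>2 \<le> (norm p)\<^sup>2 / (4 lam)\<close>, where \<open>p\<close> is the projection of \<open>v\<close> onto the range of \<open>A\<close>
    (\<open>norm_damped_sol_le\<close>). Hence \<open>lam\<close> must not be too small
    either, relative to the stepsize.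

  For the Polyak stepsize, let \<open>t = \<gamma> (h z - hstar)\<^sup>2 / (norm p)\<^sup>2\<close>. The linear step decreases \<open>norm w\<close> by
  at least \<open>t / (4 norm w)\<close>, the linearization error restores at most half of that, and
  \<open>t \<ge> \<gamma> (\<mu> norm w / L)\<^sup>2\<close>. This gives the contraction factor \<open>1 - \<gamma> \<mu>\<^sup>2 / (8 L\<^sup>2)\<close> per step, which is even
  stronger than its square root.

  For the geometric stepsize, \<open>norm w \<le> m = M q\<^sup>k\<close> is an invariant. If \<open>norm w > m / 2\<close>, then \<open>lam\<close> is
  as small relative to \<open>norm w\<close> as alignment requires, and the step decreases the distance by at
  least \<open>g \<mu> / 4\<close>, which suffices because \<open>q \<ge> 1 - \<gamma> \<mu> / (4 M)\<close>. If \<open>norm w \<le> m / 2\<close>, the step may be a bad one, but it is short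
  enough to stay within \<open>7 m / 10 \<le> q m\<close>, since \<open>q \<ge> 1 / sqrt 2\<close>.
\<close>

section \<open>Orthogonal projections\<close>

lemma orth_proj_works:
  fixes S :: "'y::euclidean_space set"
  assumes "subspace S"
  shows "orth_proj S v \<in> S" and "\<And>w. w \<in> S \<Longrightarrow> (v - orth_proj S v) \<bullet> w = 0"
proof -
  have sp: "span S = S" using assms by simp
  obtain p r where *: "p \<in> S" "\<And>w. w \<in> S \<Longrightarrow> orthogonal r w" "v = p + r"
    using orthogonal_subspace_decomp_exists[of S v] unfolding sp by metis
  then have eq: "orth_proj S v = p"
    by (intro orth_proj_unique[OF assms]) auto
  show "orth_proj S v \<in> S" "\<And>w. w \<in> S \<Longrightarrow> (v - orth_proj S v) \<bullet> w = 0"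
    unfolding eq using * by (auto simp: orthogonal_def)
qed

lemma norm_orth_proj_le:
  fixes S :: "'y::euclidean_space set"
  assumes "subspace S"
  shows "norm (orth_proj S v) \<le> norm v"
proof -
  let ?p = "orth_proj S v"
  have "orthogonal (v - ?p) ?p"
    using orth_proj_works[OF assms] by (simp add: orthogonal_def)
  from norm_add_Pythagorean[OF this]
  have "(norm v)\<^sup>2 = (norm (v - ?p))\<^sup>2 + (norm ?p)\<^sup>2" by simp
  then have "(norm ?p)\<^sup>2 \<le> (norm v)\<^sup>2" by simp
  then show ?thesis by simp
qed

section \<open>The damped projection\<close>

text \<open>The solution of the normal equations of the damped least squares problem, i.e. the minimizer
  of \<open>(norm (A d - y))\<^sup>2 + lam * (norm d)\<^sup>2\<close> over \<open>d\<close>. Applying \<open>A\<close> to it gives the damped projection of \<open>y\<close>.\<close>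

abbreviation damped_sol ::
  "('e::euclidean_space \<Rightarrow>\<^sub>L 'y::euclidean_space) \<Rightarrow> real \<Rightarrow> 'y \<Rightarrow> 'e"
where
  "damped_sol A lam y \<equiv> inv (damped_gram A lam) (adjoint (blinfun_apply A) y)"

context
  fixes A :: "'e::euclidean_space \<Rightarrow>\<^sub>L 'y::euclidean_space"
begin

lemma linear_blinfun: "linear (blinfun_apply A)"
  by (intro bounded_linear.linear blinfun.bounded_linear_right)

lemmas adj = adjoint_clauses[OF linear_blinfun]
lemmas lin_adj = adjoint_linear[OF linear_blinfun]

lemma linear_damped_gram: "linear (damped_gram A lam)"
  unfolding damped_gram_def
  by (intro linearI)
     (simp_all add: linear_add[OF linear_blinfun] linear_add[OF lin_adj]
        linear_scale[OF linear_blinfun] linear_scale[OF lin_adj] algebra_simps)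

text \<open>The adjoint vanishes on the orthogonal complement of the range. Hence everything computed from
  \<open>A\<^sup>T v\<close> sees only the projection of \<open>v\<close> onto the range, whose norm regularity bounds by \<open>L\<close>.\<close>

lemma adjoint_range_proj:
  "adjoint (blinfun_apply A) (range_proj A y) = adjoint (blinfun_apply A) y"
proof -
  have "subspace (range (blinfun_apply A))"
    using linear_subspace_image[OF linear_blinfun subspace_UNIV] .
  note * = orth_proj_works(2)[OF this]
  have "x \<bullet> adjoint (blinfun_apply A) (range_proj A y) = x \<bullet> adjoint (blinfun_apply A) y" for x
    using *[of "blinfun_apply A x" y]
    by (simp add: adj range_proj_def inner_diff_left inner_commute[of "blinfun_apply A x"])
  then show ?thesis using vector_eq_ldot by blast
qed

lemma damped_proj_range_proj: "damped_proj A lam (range_proj A y) = damped_proj A lam y"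
  by (simp add: damped_proj_def adjoint_range_proj)

context
  fixes lam :: real
  assumes lam: "lam > 0"
begin

lemma damped_gram_damped_sol:
  "damped_gram A lam (damped_sol A lam y) = adjoint (blinfun_apply A) y"
  by (rule surj_f_inv_f[OF bij_is_surj[OF bij_damped_gram[OF lam]]])

lemma damped_solI:
  assumes "damped_gram A lam d = adjoint (blinfun_apply A) y"
  shows "damped_sol A lam y = d"
  using assms bij_damped_gram[OF lam] by (metis bij_is_inj inv_f_f)

lemma linear_damped_proj: "linear (damped_proj A lam)"
proof (rule linearI)
  note sol = damped_gram_damped_sol and L = linear_damped_gram
  show "damped_proj A lam (y + z) = damped_proj A lam y + damped_proj A lam z" for y z
    unfolding damped_proj_def
    by (subst damped_solI[where d = "damped_sol A lam y + damped_sol A lam z"])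
       (simp_all add: linear_add[OF L] sol linear_add[OF lin_adj] linear_add[OF linear_blinfun])
  show "damped_proj A lam (c *\<^sub>R y) = c *\<^sub>R damped_proj A lam y" for c y
    unfolding damped_proj_def
    by (subst damped_solI[where d = "c *\<^sub>R damped_sol A lam y"])
       (simp_all add: linear_scale[OF L] sol linear_scale[OF lin_adj] linear_scale[OF linear_blinfun])
qed

lemma damped_proj_symmetric: "damped_proj A lam y \<bullet> z = y \<bullet> damped_proj A lam z"
proof -
  let ?d = "damped_sol A lam y" and ?e = "damped_sol A lam z"
  have gram: "damped_gram A lam a \<bullet> b = a \<bullet> damped_gram A lam b" for a b
    by (simp add: damped_gram_def adj inner_add_left inner_add_right)
  have "damped_proj A lam y \<bullet> z = ?d \<bullet> adjoint (blinfun_apply A) z"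
    by (simp only: damped_proj_def adj)
  also have "\<dots> = ?d \<bullet> damped_gram A lam ?e" by (simp only: damped_gram_damped_sol)
  also have "\<dots> = damped_gram A lam ?d \<bullet> ?e" by (rule gram[symmetric])
  also have "\<dots> = y \<bullet> damped_proj A lam z"
    by (simp only: damped_gram_damped_sol damped_proj_def adj)
  finally show ?thesis .
qed

text \<open>By the normal equations \<open>A\<^sup>T (y - P y) = lam d\<close>; pair this with \<open>d\<close>. An orthogonal projection
  would give zero here. The defect of the damped one is nonnegative, and this sign is what makes both \<open>P\<close>
  and \<open>I - P\<close> contractions.\<close>

lemma inner_residual_damped_proj:
  "(y - damped_proj A lam y) \<bullet> damped_proj A lam y = lam * (norm (damped_sol A lam y))\<^sup>2"
proof -
  define d where "d = damped_sol A lam y"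
  have sol: "adjoint (blinfun_apply A) y = adjoint (blinfun_apply A) (blinfun_apply A d) + lam *\<^sub>R d"
    using damped_gram_damped_sol[of y] by (simp add: damped_gram_def d_def)
  have "(y - damped_proj A lam y) \<bullet> damped_proj A lam y = (y - blinfun_apply A d) \<bullet> blinfun_apply A d"
    by (simp add: damped_proj_def d_def)
  also have "\<dots>
      = (adjoint (blinfun_apply A) y - adjoint (blinfun_apply A) (blinfun_apply A d)) \<bullet> d"
    by (simp add: inner_diff_left adj)
  also have "\<dots> = lam *\<^sub>R d \<bullet> d" by (simp add: sol)
  finally show ?thesis by (simp add: d_def power2_norm_eq_inner)
qed

lemma damped_Pythagoras:
  "(norm y)\<^sup>2 = (norm (y - damped_proj A lam y))\<^sup>2 + (norm (damped_proj A lam y))\<^sup>2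
     + 2 * lam * (norm (damped_sol A lam y))\<^sup>2"
proof -
  let ?P = "damped_proj A lam y"
  have "(norm y)\<^sup>2 = (norm ((y - ?P) + ?P))\<^sup>2" by simp
  also have "\<dots> = (norm (y - ?P))\<^sup>2 + (norm ?P)\<^sup>2 + 2 * ((y - ?P) \<bullet> ?P)"
    by (simp only: power2_norm_eq_inner inner_add_left inner_add_right inner_commute[of ?P "y - ?P"])
  finally show ?thesis by (simp add: inner_residual_damped_proj)
qed

lemma norm_damped_proj_le: "norm (damped_proj A lam y) \<le> norm y"
  and norm_residual_le: "norm (y - damped_proj A lam y) \<le> norm y"
proof -
  have "0 \<le> 2 * lam * (norm (damped_sol A lam y))\<^sup>2" using lam by simp
  with damped_Pythagoras[of y]
  have "(norm (damped_proj A lam y))\<^sup>2 \<le> (norm y)\<^sup>2"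
    "(norm (y - damped_proj A lam y))\<^sup>2 \<le> (norm y)\<^sup>2"
    using zero_le_power2[of "norm (y - damped_proj A lam y)"]
      zero_le_power2[of "norm (damped_proj A lam y)"] by linarith+
  then show "norm (damped_proj A lam y) \<le> norm y" "norm (y - damped_proj A lam y) \<le> norm y"
    by simp_all
qed

lemma norm_damped_proj_le_range_proj: "norm (damped_proj A lam y) \<le> norm (range_proj A y)"
  using norm_damped_proj_le[of "range_proj A y"] by (simp add: damped_proj_range_proj)

text \<open>Replacing \<open>y\<close> by its projection \<open>p\<close> onto the range changes nothing, and then
  \<open>lam * (norm d)\<^sup>2 = (p - P p) \<bullet> P p\<close> is at most \<open>norm p * c - c\<^sup>2\<close> with \<open>c = norm (P p)\<close>. This quadratic in \<open>c\<close>
  is maximal at \<open>c = norm p / 2\<close>. The constant \<open>1 / 4\<close> is optimal: equality holds if \<open>y\<close> is a left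
  singular vector with \<open>\<sigma>\<^sup>2 = lam > 0\<close>.\<close>

lemma norm_damped_sol_le:
  "lam * (norm (damped_sol A lam y))\<^sup>2 \<le> (norm (range_proj A y))\<^sup>2 / 4"
proof -
  let ?p = "range_proj A y" and ?P = "damped_proj A lam y"
  have "lam * (norm (damped_sol A lam y))\<^sup>2 = (?p - ?P) \<bullet> ?P"
    using inner_residual_damped_proj[of ?p]
    by (simp add: damped_proj_range_proj adjoint_range_proj)
  also have "\<dots> \<le> norm ?p * norm ?P - (norm ?P)\<^sup>2"
    using norm_cauchy_schwarz[of ?p ?P] by (simp add: inner_diff_left power2_norm_eq_inner)
  also have "\<dots> \<le> (norm ?p)\<^sup>2 / 4"
    using zero_le_power2[of "norm ?p / 2 - norm ?P"] by (simp add: power2_eq_square algebra_simps)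
  finally show ?thesis .
qed

text \<open>\<open>A\<^sup>T U\<^sub>i = \<sigma>\<^sub>i V\<^sub>i\<close>, and \<open>V\<^sub>i\<close> is an eigenvector of the damped Gram operator with eigenvalue
  \<open>\<sigma>\<^sub>i\<^sup>2 + lam\<close>, so the normal equations are solved by a multiple of \<open>V\<^sub>i\<close>.\<close>

lemma damped_proj_left_singular_vector:
  assumes svd: "is_svd A \<sigma> U V" and i: "i \<in> {1..min DIM('e) DIM('y)}"
  shows "damped_proj A lam (U i) = ((\<sigma> i)\<^sup>2 / ((\<sigma> i)\<^sup>2 + lam)) *\<^sub>R U i"
proof -
  let ?r = "min DIM('e) DIM('y)"
  have U: "U i \<bullet> U k = (if i = k then 1 else 0)" if "k \<in> {1..?r}" for k
    using svd that i by (auto simp: is_svd_def orthonormal_on_def)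
  have V: "V k \<bullet> V i = (if k = i then 1 else 0)" if "k \<in> {1..?r}" for k
    using svd that i by (auto simp: is_svd_def orthonormal_on_def)
  have A: "blinfun_apply A d = (\<Sum>k=1..?r. (\<sigma> k * (V k \<bullet> d)) *\<^sub>R U k)" for d
    using svd by (simp add: is_svd_def)
  have "blinfun_apply A (V i) = (\<Sum>k\<in>{1..?r}. if k = i then \<sigma> i *\<^sub>R U i else 0)"
    unfolding A by (intro sum.cong) (auto simp: V)
  then have AV: "blinfun_apply A (V i) = \<sigma> i *\<^sub>R U i" using i by (simp add: sum.delta)
  have "d \<bullet> adjoint (blinfun_apply A) (U i) = d \<bullet> (\<sigma> i *\<^sub>R V i)" for d
  proof -
    have "d \<bullet> adjoint (blinfun_apply A) (U i) = (\<Sum>k=1..?r. (\<sigma> k * (V k \<bullet> d)) * (U i \<bullet> U k))"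
      by (simp add: adj A inner_sum_left inner_commute[of "U i"])
    also have "\<dots> = (\<Sum>k\<in>{1..?r}. if k = i then \<sigma> i * (V i \<bullet> d) else 0)"
      by (intro sum.cong) (auto simp: U)
    finally show ?thesis using i by (simp add: sum.delta inner_commute)
  qed
  then have AU: "adjoint (blinfun_apply A) (U i) = \<sigma> i *\<^sub>R V i" using vector_eq_ldot by blast
  have pos: "(\<sigma> i)\<^sup>2 + lam > 0" using lam by (simp add: add_nonneg_pos)
  have "damped_gram A lam ((\<sigma> i / ((\<sigma> i)\<^sup>2 + lam)) *\<^sub>R V i)
      = (\<sigma> i / ((\<sigma> i)\<^sup>2 + lam)) *\<^sub>R (((\<sigma> i)\<^sup>2 + lam) *\<^sub>R V i)"
    by (simp only: linear_scale[OF linear_damped_gram])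
       (simp add: damped_gram_def AV linear_scale[OF lin_adj] AU power2_eq_square algebra_simps)
  also have "\<dots> = adjoint (blinfun_apply A) (U i)" using pos by (simp add: AU)
  finally have "damped_sol A lam (U i) = (\<sigma> i / ((\<sigma> i)\<^sup>2 + lam)) *\<^sub>R V i" by (rule damped_solI)
  then show ?thesis
    by (simp add: damped_proj_def linear_scale[OF linear_blinfun] AV power2_eq_square)
qed

text \<open>Split \<open>w\<close> into its projection onto the span of the top \<open>j\<close> left singular vectors and the tail.
  On the head, \<open>I - P\<close> is diagonal with entries \<open>lam / (\<sigma>\<^sub>i\<^sup>2 + lam) \<le> lam / \<sigma>\<^sub>j\<^sup>2 \<le> \<tau>\<close> whenever \<open>\<sigma>\<^sub>j > 0\<close>;
  the tail has norm at most \<open>\<rho> * norm w\<close>, and \<open>I - P\<close> does not expand it.\<close>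

lemma residual_le_if_aligned:
  assumes svd: "is_svd A \<sigma> U V" and j: "j \<in> {1..min DIM('e) DIM('y)}"
    and tau: "0 \<le> \<tau>" "lam \<le> \<tau> * (\<sigma> j)\<^sup>2"
    and tail: "norm (w - top_proj U j w) \<le> \<rho> * norm w"
  shows "norm (w - damped_proj A lam w) \<le> (\<rho> + \<tau>) * norm w"
proof -
  let ?R = "\<lambda>y. y - damped_proj A lam y"
  let ?p = "\<Sum>i\<in>{1..j}. (U i \<bullet> w) *\<^sub>R U i"
  define f where "f i = lam / ((\<sigma> i)\<^sup>2 + lam)" for i
  have U: "U i \<bullet> U k = (if i = k then 1 else 0)" if "i \<in> {1..j}" "k \<in> {1..j}" for i k
    using svd that j by (auto simp: is_svd_def orthonormal_on_def)
  have norm_comb: "(norm (\<Sum>i\<in>{1..j}. c i *\<^sub>R U i))\<^sup>2 = (\<Sum>i\<in>{1..j}. (c i)\<^sup>2)" for c :: "nat \<Rightarrow> real"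
  proof -
    have "(norm (\<Sum>i\<in>{1..j}. c i *\<^sub>R U i))\<^sup>2 = (\<Sum>i\<in>{1..j}. (norm (c i *\<^sub>R U i))\<^sup>2)"
      by (intro norm_sum_Pythagorean) (auto simp: pairwise_def orthogonal_def U)
    also have "\<dots> = (\<Sum>i\<in>{1..j}. (c i)\<^sup>2)"
      by (intro sum.cong) (auto simp: norm_eq_sqrt_inner U power_mult_distrib)
    finally show ?thesis .
  qed
  have top: "top_proj U j w = ?p"
    unfolding top_proj_def
  proof (rule orth_proj_unique)
    show "?p \<in> span (U ` {1..j})" by (intro span_sum span_scale span_base) auto
    have orth: "orthogonal (w - ?p) (U k)" if "k \<in> {1..j}" for k
    proof -
      have "?p \<bullet> U k = (\<Sum>i\<in>{1..j}. if i = k then U k \<bullet> w else 0)"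
        unfolding inner_sum_left using U[OF _ that] by (intro sum.cong refl) simp
      then have "?p \<bullet> U k = w \<bullet> U k" using that by (simp add: inner_commute)
      then show ?thesis by (simp only: orthogonal_def inner_diff_left diff_self)
    qed
    show "orthogonal (w - ?p) y" if "y \<in> span (U ` {1..j})" for y
      by (rule orthogonal_to_span[OF that]) (use orth in blast)
  qed (rule subspace_span)
  have norm_p: "norm ?p \<le> norm w"
    using norm_orth_proj_le[of "span (U ` {1..j})" w] top by (simp only: top_proj_def subspace_span)
  have f: "0 \<le> f i" "f i \<le> \<tau>" if "i \<in> {1..j}" for i
  proof -
    have pos: "(\<sigma> i)\<^sup>2 + lam > 0" using lam by (simp add: add_nonneg_pos)
    show "0 \<le> f i" using lam pos by (simp add: f_def)
    have "0 \<le> \<sigma> j" "\<sigma> j \<le> \<sigma> i" using svd that j by (auto simp: is_svd_def)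
    then have "(\<sigma> j)\<^sup>2 \<le> (\<sigma> i)\<^sup>2 + lam" using lam
      by (meson add_increasing2 less_imp_le power_mono)
    then have "lam \<le> \<tau> * ((\<sigma> i)\<^sup>2 + lam)" using tau by (meson mult_left_mono order_trans)
    then show "f i \<le> \<tau>" using pos by (simp add: f_def divide_le_eq)
  qed
  have "?R ?p = (\<Sum>i\<in>{1..j}. (f i * (U i \<bullet> w)) *\<^sub>R U i)"
  proof -
    have "damped_proj A lam ?p
        = (\<Sum>i\<in>{1..j}. ((U i \<bullet> w) * ((\<sigma> i)\<^sup>2 / ((\<sigma> i)\<^sup>2 + lam))) *\<^sub>R U i)"
      unfolding linear_sum[OF linear_damped_proj] linear_scale[OF linear_damped_proj]
      using j by (intro sum.cong) (auto simp: damped_proj_left_singular_vector[OF svd])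
    then have "?R ?p = (\<Sum>i\<in>{1..j}. ((U i \<bullet> w) - (U i \<bullet> w) * ((\<sigma> i)\<^sup>2 / ((\<sigma> i)\<^sup>2 + lam))) *\<^sub>R U i)"
      by (simp add: sum_subtractf scaleR_diff_left)
    moreover have "(U i \<bullet> w) - (U i \<bullet> w) * ((\<sigma> i)\<^sup>2 / ((\<sigma> i)\<^sup>2 + lam)) = f i * (U i \<bullet> w)" for i
    proof -
      have "(\<sigma> i)\<^sup>2 + lam \<noteq> 0" using lam by (simp add: add_nonneg_pos order_less_imp_not_eq2)
      then show ?thesis by (simp add: f_def field_simps)
    qed
    ultimately show ?thesis by simp
  qed
  then have "(norm (?R ?p))\<^sup>2 = (\<Sum>i\<in>{1..j}. (f i)\<^sup>2 * (U i \<bullet> w)\<^sup>2)"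
    by (simp only: norm_comb power_mult_distrib)
  also have "\<dots> \<le> (\<Sum>i\<in>{1..j}. \<tau>\<^sup>2 * (U i \<bullet> w)\<^sup>2)"
    using f by (intro sum_mono mult_right_mono power_mono) auto
  also have "\<dots> = (\<tau> * norm ?p)\<^sup>2"
    by (simp only: norm_comb power_mult_distrib sum_distrib_left)
  finally have "norm (?R ?p) \<le> \<tau> * norm ?p"
    by (rule power2_le_imp_le) (intro mult_nonneg_nonneg tau(1) norm_ge_zero)
  also have "\<dots> \<le> \<tau> * norm w" by (rule mult_left_mono[OF norm_p tau(1)])
  finally have head: "norm (?R ?p) \<le> \<tau> * norm w" .
  have "norm (?R w) = norm (?R (w - ?p) + ?R ?p)"
    by (simp add: linear_diff[OF linear_damped_proj])
  also have "\<dots> \<le> norm (?R (w - ?p)) + norm (?R ?p)" by (rule norm_triangle_ineq)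
  also have "\<dots> \<le> norm (w - ?p) + \<tau> * norm w"
    by (rule add_mono[OF norm_residual_le head])
  also have "\<dots> \<le> (\<rho> + \<tau>) * norm w"
    using tail unfolding top by (simp only: distrib_right add_right_mono)
  finally show ?thesis .
qed

end

end

section \<open>Linearization error\<close>

text \<open>Along the segment, \<open>F (x + t d) - t A d\<close> has derivative of norm at most \<open>LF * t * (norm d)\<^sup>2\<close>;
  integrating over \<open>t\<close> from \<open>0\<close> to \<open>1\<close> produces the factor \<open>1 / 2\<close>.\<close>

lemma taylor_remainder_le:
  fixes F :: "'e::real_normed_vector \<Rightarrow> 'y::real_normed_vector"
  assumes der: "\<And>x. (F has_derivative blinfun_apply (DF x)) (at x)"
    and lip: "LF-lipschitz_on UNIV DF"
  shows "norm (F (x + d) - F x - blinfun_apply (DF x) d) \<le> LF / 2 * (norm d)\<^sup>2"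
proof -
  define f where "f t = F (x + t *\<^sub>R d) - t *\<^sub>R blinfun_apply (DF x) d" for t :: real
  define \<phi> where "\<phi> t = LF * (norm d)\<^sup>2 * t\<^sup>2 / 2" for t :: real
  have f': "(f has_vector_derivative
      (blinfun_apply (DF (x + t *\<^sub>R d)) d - blinfun_apply (DF x) d)) (at t)" for t
  proof -
    have "((\<lambda>t. F (x + t *\<^sub>R d)) has_derivative
        (\<lambda>u. blinfun_apply (DF (x + t *\<^sub>R d)) (u *\<^sub>R d))) (at t)"
      by (rule has_derivative_compose[OF _ der]) (auto intro!: derivative_eq_intros)
    then show ?thesis
      unfolding f_def has_vector_derivative_def
      by (auto intro!: derivative_eq_intros simp: blinfun.scaleR_right algebra_simps)
  qed
  have \<phi>': "(\<phi> has_vector_derivative (LF * (norm d)\<^sup>2 * t)) (at t)" for t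
    unfolding \<phi>_def has_real_derivative_iff_has_vector_derivative[symmetric]
    by (auto intro!: derivative_eq_intros)
  have "norm (f 1 - f 0) \<le> \<phi> 1 - \<phi> 0"
  proof (rule differentiable_bound_general[OF _ _ _ f' \<phi>'])
    fix t :: real assume t: "0 < t" "t < 1"
    have "norm (blinfun_apply (DF (x + t *\<^sub>R d)) d - blinfun_apply (DF x) d)
        \<le> norm (DF (x + t *\<^sub>R d) - DF x) * norm d"
      by (metis blinfun.diff_left norm_blinfun)
    also have "\<dots> \<le> (LF * norm (t *\<^sub>R d)) * norm d"
      using lipschitz_onD[OF lip, of "x + t *\<^sub>R d" x] by (simp add: dist_norm mult_right_mono)
    finally show "norm (blinfun_apply (DF (x + t *\<^sub>R d)) d - blinfun_apply (DF x) d)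
        \<le> LF * (norm d)\<^sup>2 * t" using t by (simp add: power2_eq_square mult_ac)
  next
    show "continuous_on {0..1} f"
      using f' has_vector_derivative_continuous by (blast intro: continuous_at_imp_continuous_on)
    show "continuous_on {0..1} \<phi>"
      using \<phi>' has_vector_derivative_continuous by (blast intro: continuous_at_imp_continuous_on)
  qed simp
  then show ?thesis by (simp add: f_def \<phi>_def algebra_simps)
qed

section \<open>One step of the method\<close>

lemma min_value_eq_if_minimizers_on:
  assumes "minimizers_on h S = {z}"
  shows "min_value h S = h z"
proof -
  have "is_arg_min h (\<lambda>z. z \<in> S) z" using assms by (auto simp: minimizers_on_def)
  then have z: "z \<in> S" "\<And>y. y \<in> S \<Longrightarrow> h z \<le> h y"
    by (auto simp: is_arg_min_linorder)
  show "min_value h S = h z"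
    unfolding min_value_def using z by (intro cInf_eq_minimum) auto
qed

text \<open>Converts a decrease of the squared distance into a decrease of the distance, which can then be
  added to the linearization error.\<close>

lemma le_diff_if_power2_le:
  fixes a b y :: real
  assumes "0 < a" and "y\<^sup>2 \<le> a\<^sup>2 - 2 * a * b"
  shows "y \<le> a - b"
proof (rule power2_le_imp_le)
  show "y\<^sup>2 \<le> (a - b)\<^sup>2"
    unfolding power2_diff using assms(2) zero_le_power2[of b] by linarith
  have "a * (a - 2 * b) = a\<^sup>2 - 2 * a * b" by (simp add: power2_eq_square algebra_simps)
  then have "0 \<le> a * (a - 2 * b)" using assms(2) zero_le_power2[of y] by linarith
  then have "0 \<le> a - 2 * b" using assms(1) by (simp add: zero_le_mult_iff)
  then show "0 \<le> a - b" using assms(1) by linarith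
qed

lemma power2_norm_diff_scaleR:
  fixes w u :: "'a::real_inner"
  shows "(norm (w - g *\<^sub>R u))\<^sup>2 = (norm w)\<^sup>2 - 2 * g * (u \<bullet> w) + g\<^sup>2 * (norm u)\<^sup>2"
  by (simp only: power2_norm_eq_inner inner_diff_left inner_diff_right inner_scaleR_left
        inner_scaleR_right inner_commute[of w u])
     (simp add: power2_eq_square algebra_simps)

locale aligned_composite =
  fixes h :: "'y::euclidean_space \<Rightarrow> real"
    and F :: "'e::euclidean_space \<Rightarrow> 'y"
    and DF :: "'e \<Rightarrow> 'e \<Rightarrow>\<^sub>L 'y"
    and \<sigma> :: "'e \<Rightarrow> nat \<Rightarrow> real"
    and U :: "'e \<Rightarrow> nat \<Rightarrow> 'y"
    and V :: "'e \<Rightarrow> nat \<Rightarrow> 'e"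
    and \<mu> L LF :: real
    and \<delta> s :: "real \<Rightarrow> real"
    and zstar :: 'y
  assumes der: "\<And>x. (F has_derivative blinfun_apply (DF x)) (at x)"
    and svd: "\<And>x. is_svd (DF x) (\<sigma> x) (U x) (V x)"
    and lip: "LF-lipschitz_on UNIV DF"
    and reg: "nonsmooth_regular h F DF \<mu> L zstar"
    and aligned: "weakly_aligned F \<sigma> U zstar \<delta> s"
begin

abbreviation "hstar \<equiv> min_value h (range F)"

abbreviation "lmm_step x g lam v \<equiv> x - g *\<^sub>R damped_sol (DF x) lam v"

lemma mu_pos: "\<mu> > 0" and L_pos: "L > 0"
  and minimizers: "minimizers_on h (range F) = {zstar}"
  and sharp: "\<mu> * norm (F x - zstar) \<le> h (F x) - hstar"
  and range_proj_le: "v \<in> subdifferential h (F x) \<Longrightarrow> norm (range_proj (DF x) v) \<le> L"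
  using reg by (auto simp: nonsmooth_regular_def)

lemma LF_nonneg: "LF \<ge> 0"
  using lip by (rule lipschitz_on_nonneg)

text \<open>Weak alignment supplies the index \<open>j\<close> for the spectral bound. The damping may be as large as a
  fraction \<open>\<tau>\<close> of the guaranteed lower bound \<open>s \<rho> * norm (F x - zstar)\<close> for \<open>\<sigma>\<^sub>j\<^sup>2\<close>.\<close>

lemma residual_le:
  assumes "\<rho> > 0" "norm (F x - zstar) \<le> \<delta> \<rho>"
    and "lam > 0" "0 \<le> \<tau>" "lam \<le> \<tau> * (s \<rho> * norm (F x - zstar))"
  shows "norm ((F x - zstar) - damped_proj (DF x) lam (F x - zstar))
           \<le> (\<rho> + \<tau>) * norm (F x - zstar)"
proof -
  have "F x \<in> cball zstar (\<delta> \<rho>)" using assms(2) by (simp add: dist_norm norm_minus_commute)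
  then obtain j where j: "j \<in> {1..min DIM('e) DIM('y)}"
    "norm ((F x - zstar) - top_proj (U x) j (F x - zstar)) \<le> \<rho> * norm (F x - zstar)"
    "s \<rho> * norm (F x - zstar) \<le> (\<sigma> x j)\<^sup>2"
    using aligned assms(1) unfolding weakly_aligned_def by meson
  have "lam \<le> \<tau> * (\<sigma> x j)\<^sup>2" using assms(4,5) j(3) by (meson mult_left_mono order_trans)
  from residual_le_if_aligned[OF assms(3) svd j(1) assms(4) this j(2)] show ?thesis .
qed

text \<open>Short moves along \<open>- P v\<close> approach \<open>zstar\<close> as soon as \<open>L * norm (w - P w)\<close> is below
  the gap. By symmetry \<open>P v \<bullet> w = v \<bullet> P w\<close>, and \<open>P w\<close>
  differs from \<open>w\<close> by the residual.\<close>

lemma damped_direction_correlates: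
  assumes v: "v \<in> subdifferential h (F x)" and lam: "lam > 0"
  shows "h (F x) - hstar - L * norm ((F x - zstar) - damped_proj (DF x) lam (F x - zstar))
           \<le> damped_proj (DF x) lam v \<bullet> (F x - zstar)"
proof -
  let ?w = "F x - zstar" and ?P = "damped_proj (DF x) lam"
  have "h (F x) - hstar \<le> v \<bullet> ?w"
    using v min_value_eq_if_minimizers_on[OF minimizers]
    by (auto simp: subdifferential_def inner_diff_right dest: spec[of _ zstar])
  also have "\<dots> = v \<bullet> ?P ?w + v \<bullet> (?w - ?P ?w)" by (simp add: inner_diff_right)
  also have "v \<bullet> (?w - ?P ?w) \<le> L * norm (?w - ?P ?w)"
    using reg v lam by (auto simp: nonsmooth_regular_def intro: order_trans[OF abs_ge_self])
  finally show ?thesis by (simp add: damped_proj_symmetric[OF lam])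
qed

text \<open>\<open>F\<close> moves by \<open>- g P v\<close> plus the linearization error, and the bound on the damped solution
  turns that error into a multiple of \<open>1 / lam\<close>.\<close>

lemma norm_lmm_step_le:
  assumes "lam > 0"
  shows "norm (F (lmm_step x g lam v) - zstar)
     \<le> norm ((F x - zstar) - g *\<^sub>R damped_proj (DF x) lam v)
        + LF * g\<^sup>2 * (norm (range_proj (DF x) v))\<^sup>2 / (8 * lam)"
proof -
  let ?d = "damped_sol (DF x) lam v" and ?p = "norm (range_proj (DF x) v)"
  let ?e = "F (lmm_step x g lam v) - F x - blinfun_apply (DF x) (- g *\<^sub>R ?d)"
  have "(norm ?d)\<^sup>2 \<le> ?p\<^sup>2 / (4 * lam)"
    using norm_damped_sol_le[OF assms, of "DF x" v] assms by (simp add: field_simps)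
  then have "LF / 2 * g\<^sup>2 * (norm ?d)\<^sup>2 \<le> LF / 2 * g\<^sup>2 * (?p\<^sup>2 / (4 * lam))"
    using LF_nonneg by (intro mult_left_mono) auto
  moreover have "norm ?e \<le> LF / 2 * g\<^sup>2 * (norm ?d)\<^sup>2"
    using taylor_remainder_le[OF der lip, of x "- g *\<^sub>R ?d"] by (simp add: power_mult_distrib)
  ultimately have e: "norm ?e \<le> LF * g\<^sup>2 * ?p\<^sup>2 / (8 * lam)" by simp
  have "norm (F (lmm_step x g lam v) - zstar)
      = norm (((F x - zstar) - g *\<^sub>R damped_proj (DF x) lam v) + ?e)"
    by (simp add: damped_proj_def blinfun.scaleR_right blinfun.minus_right)
  also have "\<dots> \<le> norm ((F x - zstar) - g *\<^sub>R damped_proj (DF x) lam v) + norm ?e"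
    by (rule norm_triangle_ineq)
  finally show ?thesis using e by linarith
qed

text \<open>Sharpness bounds the gap below by \<open>\<mu> * norm w\<close>. It is at most \<open>v \<bullet> P w + v \<bullet> (w - P w)\<close>, and
  regularity bounds each of these terms by \<open>L * norm w\<close>. The value \<open>1\<close> of the damping is arbitrary. Some point of
  the range other than \<open>zstar\<close> is needed: if \<open>F\<close> is constant, \<open>\<mu>\<close> and \<open>L\<close> are unrelated.\<close>

lemma mu_le:
  assumes v: "v \<in> subdifferential h (F x)" and ne: "F x \<noteq> zstar"
  shows "\<mu> \<le> 2 * L"
proof -
  let ?w = "F x - zstar"
  have "\<mu> * norm ?w \<le> h (F x) - hstar" by (rule sharp)
  also have "\<dots> \<le> damped_proj (DF x) 1 v \<bullet> ?w + L * norm (?w - damped_proj (DF x) 1 ?w)"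
    using damped_direction_correlates[OF v, of 1] by simp
  also have "\<dots> \<le> L * norm ?w + L * norm ?w"
  proof (rule add_mono)
    have "damped_proj (DF x) 1 v \<bullet> ?w \<le> norm (damped_proj (DF x) 1 v) * norm ?w"
      by (rule norm_cauchy_schwarz)
    also have "\<dots> \<le> L * norm ?w"
      using norm_damped_proj_le_range_proj[of 1 "DF x" v] range_proj_le[OF v]
      by (intro mult_right_mono) auto
    finally show "damped_proj (DF x) 1 v \<bullet> ?w \<le> L * norm ?w" .
    show "L * norm (?w - damped_proj (DF x) 1 ?w) \<le> L * norm ?w"
      using L_pos by (intro mult_left_mono norm_residual_le) auto
  qed
  finally have "\<mu> * norm ?w \<le> (2 * L) * norm ?w" by simp
  then show ?thesis using ne by simp
qed

text \<open>Let \<open>a\<close> be the distance to \<open>zstar\<close>. The choice \<open>\<rho> = \<tau> = \<mu> / (8 * L)\<close> makes the residual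
  cost at most \<open>\<mu> * a / 4\<close>, which is at most a quarter of the gap. The squared distance thus changes by at most \<open>- (3 / 2) * t + \<gamma> * t \<le> - t / 2\<close>. The damping satisfies
  \<open>lam \<ge> LF * \<gamma> * a\<close>, so the linearization error is at most \<open>t / (8 * a)\<close>.\<close>

lemma polyak_step:
  assumes v: "v \<in> subdifferential h (F x)" and near: "norm (F x - zstar) \<le> \<delta> (\<mu> / (8 * L))"
    and lam: "lam > 0" "lam \<le> Cub * norm (F x - zstar)" "Clb * norm (F x - zstar) \<le> lam"
    and Cub: "Cub \<le> \<mu> / (8 * L) * s (\<mu> / (8 * L))"
    and \<gamma>: "0 < \<gamma>" "\<gamma> \<le> 1" "LF * \<gamma> \<le> Clb"
    and g: "g = \<gamma> * ((h (F x) - hstar) / (norm (range_proj (DF x) v))\<^sup>2)" "g > 0"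
  shows "norm (F (lmm_step x g lam v) - zstar)
           \<le> (1 - \<gamma> * \<mu>\<^sup>2 / (8 * L\<^sup>2)) * norm (F x - zstar)"
proof -
  define \<rho> where "\<rho> = \<mu> / (8 * L)"
  define a where "a = norm (F x - zstar)"
  define \<Delta> where "\<Delta> = h (F x) - hstar"
  define p where "p = norm (range_proj (DF x) v)"
  define t where "t = \<gamma> * \<Delta>\<^sup>2 / p\<^sup>2"
  let ?w = "F x - zstar" and ?u = "damped_proj (DF x) lam v"
  note mu = mu_pos and L = L_pos
  have \<rho>: "\<rho> > 0" using mu L by (simp add: \<rho>_def)
  have "a \<noteq> 0" using lam by (auto simp: a_def)
  then have a: "a > 0" by (simp add: a_def)
  (* if p = 0, the quotient in the stepsize is 0 in HOL, contrary to g > 0 *)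
  have "p \<noteq> 0" using g by (auto simp: p_def)
  then have p: "p > 0" by (simp add: p_def)
  have pL: "p \<le> L" using range_proj_le[OF v] by (simp add: p_def)
  have \<Delta>: "\<mu> * a \<le> \<Delta>" using sharp[of x] by (simp add: a_def \<Delta>_def)
  have gt: "g * \<Delta> = t" "g\<^sup>2 * p\<^sup>2 = \<gamma> * t"
    using g p by (simp_all add: t_def \<Delta>_def p_def power2_eq_square)
  have t: "t \<ge> 0" using \<gamma> by (simp add: t_def)
  have "lam \<le> \<rho> * (s \<rho> * a)"
    using lam(2) mult_right_mono[OF Cub, of a] a by (simp add: \<rho>_def a_def)
  then have "norm (?w - damped_proj (DF x) lam ?w) \<le> (\<rho> + \<rho>) * a"
    unfolding a_def using \<rho> near lam(1) by (intro residual_le) (auto simp: \<rho>_def)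
  then have "L * norm (?w - damped_proj (DF x) lam ?w) \<le> L * ((\<rho> + \<rho>) * a)"
    using L by (intro mult_left_mono) auto
  also have "\<dots> = \<mu> * a / 4" using L by (simp add: \<rho>_def)
  finally have corr: "3 / 4 * \<Delta> \<le> ?u \<bullet> ?w"
    using damped_direction_correlates[OF v lam(1)] \<Delta> by (simp add: \<Delta>_def)
  have u: "(norm ?u)\<^sup>2 \<le> p\<^sup>2"
    using norm_damped_proj_le_range_proj[OF lam(1)] by (simp add: p_def power_mono)
  have "(norm (?w - g *\<^sub>R ?u))\<^sup>2 \<le> a\<^sup>2 - 2 * g * (3 / 4 * \<Delta>) + g\<^sup>2 * p\<^sup>2"
    unfolding power2_norm_diff_scaleR a_def[symmetric]
    using g(2) corr u by (intro add_mono diff_mono mult_left_mono) auto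
  also have "\<dots> = a\<^sup>2 - 3 / 2 * t + \<gamma> * t" using gt by simp
  also have "\<dots> \<le> a\<^sup>2 - t / 2"
    using mult_right_mono[OF \<gamma>(2) t] by simp
  also have "\<dots> = a\<^sup>2 - 2 * a * (t / (4 * a))" using a by simp
  finally have main: "norm (?w - g *\<^sub>R ?u) \<le> a - t / (4 * a)" by (rule le_diff_if_power2_le[OF a])
  have "LF * \<gamma> * a \<le> lam"
    using mult_right_mono[OF \<gamma>(3) norm_ge_zero] lam(3) unfolding a_def by (rule order_trans)
  then have "LF * \<gamma> * a * t \<le> lam * t" using t by (rule mult_right_mono)
  then have "LF * (\<gamma> * t) / (8 * lam) \<le> t / (8 * a)"
    using a lam(1) by (simp add: field_simps)
  then have err: "LF * g\<^sup>2 * p\<^sup>2 / (8 * lam) \<le> t / (8 * a)" using gt by (simp add: mult.assoc)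
  have "\<gamma> * \<mu>\<^sup>2 / L\<^sup>2 * a\<^sup>2 = \<gamma> * (\<mu> * a)\<^sup>2 / L\<^sup>2" by (simp add: power_mult_distrib)
  also have "\<dots> \<le> t"
    unfolding t_def using \<gamma> \<Delta> mu a p pL
    by (intro frac_le mult_left_mono power_mono) auto
  finally have "\<gamma> * \<mu>\<^sup>2 / (8 * L\<^sup>2) * a \<le> t / (8 * a)"
    using a by (simp add: field_simps power2_eq_square)
  with norm_lmm_step_le[OF lam(1), of x g v] main err show ?thesis
    by (simp add: a_def[symmetric] p_def[symmetric] algebra_simps)
qed

text \<open>Either the iterate is far from \<open>zstar\<close> on the scale \<open>m\<close>, and the step makes progress, or it is
  close, and it suffices that the step is short. Both outcomes are at most \<open>q * m\<close> when
  \<open>q \<ge> 7 / 10\<close> and \<open>q * m \<ge> m - g * \<mu> / 4\<close>.\<close>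

lemma geometric_step:
  fixes m g lam :: real
  assumes v: "v \<in> subdifferential h (F x)"
    and near: "norm (F x - zstar) \<le> m" and m: "0 < m" "m \<le> \<delta> (\<mu> / (8 * L))"
    and mu_L: "\<mu> \<le> 2 * L"
    and lam: "0 < lam" "lam \<le> m * s (\<mu> / (8 * L)) / 128 * (\<mu> / L)"
    and g: "0 < g" "g * L\<^sup>2 \<le> m * \<mu> / 64" "LF * g * L\<^sup>2 \<le> lam * \<mu> / 2"
  shows "norm (F (lmm_step x g lam v) - zstar) \<le> max (7 / 10 * m) (m - g * \<mu> / 4)"
proof -
  define \<rho> where "\<rho> = \<mu> / (8 * L)"
  define a where "a = norm (F x - zstar)"
  define p where "p = norm (range_proj (DF x) v)"
  let ?w = "F x - zstar" and ?u = "damped_proj (DF x) lam v"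
  note mu = mu_pos and L = L_pos
  have \<rho>: "\<rho> > 0" using mu L by (simp add: \<rho>_def)
  have p: "0 \<le> p" "p \<le> L" using range_proj_le[OF v] by (simp_all add: p_def)
  have u: "norm ?u \<le> L"
    using norm_damped_proj_le_range_proj[OF lam(1), of "DF x" v] p by (simp add: p_def)
  have "LF * g\<^sup>2 * p\<^sup>2 \<le> LF * g\<^sup>2 * L\<^sup>2"
    using LF_nonneg p by (intro mult_left_mono power_mono) auto
  also have "\<dots> \<le> g * (lam * \<mu> / 2)"
    using mult_left_mono[OF g(3), of g] g(1) by (simp add: power2_eq_square mult_ac)
  finally have err: "LF * g\<^sup>2 * p\<^sup>2 / (8 * lam) \<le> g * \<mu> / 16"
    using lam(1) by (simp add: field_simps)
  have step: "norm (F (lmm_step x g lam v) - zstar) \<le> norm (?w - g *\<^sub>R ?u) + g * \<mu> / 16"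
    using norm_lmm_step_le[OF lam(1), of x g v] err by (simp add: p_def)
  show ?thesis
  proof (cases "a \<le> m / 2")
    case True
    (* mu_L turns the stepsize bound into g * L \<le> m / 32, so that the total is at most
       m / 2 + m / 32 + m / 256 *)
    have "m * \<mu> \<le> m * (2 * L)" using mu_L m(1) by (intro mult_left_mono) auto
    then have "g * L * L \<le> m / 32 * L" using g(2) by (simp add: power2_eq_square mult.assoc)
    then have gL: "g * L \<le> m / 32" using L by simp
    have "norm (?w - g *\<^sub>R ?u) \<le> a + g * norm ?u"
      using norm_triangle_ineq4[of ?w "g *\<^sub>R ?u"] g(1) by (simp add: a_def)
    also have "g * norm ?u \<le> g * L" using u g(1) by (intro mult_left_mono) auto
    finally have "norm (?w - g *\<^sub>R ?u) \<le> m / 2 + m / 32" using gL True by linarith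
    moreover have "g * \<mu> \<le> m / 16"
    proof -
      have "g * \<mu> \<le> g * (2 * L)" using mu_L g(1) by (intro mult_left_mono) auto
      also have "\<dots> = 2 * (g * L)" by simp
      finally show ?thesis using gL by linarith
    qed
    ultimately show ?thesis using step m(1) by (simp add: max_def)
  next
    case False
    (* lam is at most a multiple of m \<le> 2 * a, so residual_le applies with \<tau> = \<rho> / 8, and the residual
       costs at most 9 / 64 of \<mu> * a *)
    then have a: "a > 0" "m \<le> 2 * a" using m(1) by linarith+
    have s: "s \<rho> > 0" using aligned \<rho> by (auto simp: weakly_aligned_def)
    have "lam \<le> m * (s \<rho> / 128 * (\<mu> / L))" using lam(2) by (simp add: \<rho>_def mult_ac)
    also have "\<dots> \<le> 2 * a * (s \<rho> / 128 * (\<mu> / L))"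
      using a s mu L by (intro mult_right_mono) auto
    finally have "lam \<le> \<rho> / 8 * (s \<rho> * a)" by (simp add: \<rho>_def mult_ac)
    then have "norm (?w - damped_proj (DF x) lam ?w) \<le> (\<rho> + \<rho> / 8) * a"
      unfolding a_def using \<rho> near m lam(1) by (intro residual_le) (auto simp: \<rho>_def)
    then have "L * norm (?w - damped_proj (DF x) lam ?w) \<le> L * ((\<rho> + \<rho> / 8) * a)"
      using L by (intro mult_left_mono) auto
    also have "\<dots> = 9 / 64 * (\<mu> * a)" using L by (simp add: \<rho>_def field_simps)
    finally have corr: "55 / 64 * (\<mu> * a) \<le> ?u \<bullet> ?w"
      using damped_direction_correlates[OF v lam(1)] sharp[of x] by (simp add: a_def)
    have "g * L\<^sup>2 \<le> a * \<mu> / 32" using g(2) mult_right_mono[OF a(2) less_imp_le[OF mu]] by linarith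
    then have "g\<^sup>2 * L\<^sup>2 \<le> g * (a * \<mu> / 32)"
      using g(1) by (simp add: power2_eq_square mult.assoc)
    moreover have "g\<^sup>2 * (norm ?u)\<^sup>2 \<le> g\<^sup>2 * L\<^sup>2"
      using u by (intro mult_left_mono power_mono) auto
    moreover have "2 * g * (55 / 64 * (\<mu> * a)) \<le> 2 * g * (?u \<bullet> ?w)"
      using corr g(1) by (intro mult_left_mono) auto
    ultimately have "(norm (?w - g *\<^sub>R ?u))\<^sup>2 \<le> a\<^sup>2 - 2 * a * (27 / 32 * (g * \<mu>))"
      unfolding power2_norm_diff_scaleR a_def[symmetric] by (simp add: algebra_simps)
    then have "norm (?w - g *\<^sub>R ?u) \<le> a - 27 / 32 * (g * \<mu>)" by (rule le_diff_if_power2_le[OF a(1)])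
    moreover have "g * \<mu> > 0" using g(1) mu by simp
    ultimately have "norm (F (lmm_step x g lam v) - zstar) \<le> m - g * \<mu> / 4"
      using step near by (simp add: a_def)
    then show ?thesis by simp
  qed
qed

section \<open>Convergence rates\<close>

text \<open>The damping is positive but bounded by a multiple of the distance to \<open>zstar\<close>, so no iterate
  reaches \<open>zstar\<close>. The contraction factor \<open>r\<close> is therefore positive, which the power with a real
  exponent needs: in HOL \<open>0 powr 0 = 0\<close>, and the claim would fail at \<open>k = 0\<close> for a vanishing base.\<close>

theorem polyak_rate:
  assumes lmm: "lmm_subgradient h F DF x0 gam lam v x"
    and pol: "polyak_config h F DF \<gamma> Clb Cub gam lam v x"
    and cap: "\<gamma> \<le> polyak_cap Clb LF"
    and Cub: "Cub \<le> \<mu> / (8 * L) * s (\<mu> / (8 * L))"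
    and near: "norm (F x0 - zstar) \<le> \<delta> (\<mu> / (8 * L))"
  shows "norm (F (x k) - zstar)
           \<le> (1 - \<gamma> * \<mu>\<^sup>2 / (8 * L\<^sup>2)) powr (real k / 2) * norm (F x0 - zstar)"
proof -
  define r where "r = 1 - \<gamma> * \<mu>\<^sup>2 / (8 * L\<^sup>2)"
  define a where "a k = norm (F (x k) - zstar)" for k
  have "infdist z {zstar} = norm (z - zstar)" for z by (simp add: dist_norm)
  then have lam: "lam i > 0" "Clb * a i \<le> lam i" "lam i \<le> Cub * a i" for i
    using lmm pol by (auto simp: lmm_subgradient_def polyak_config_def minimizers a_def)
  have x: "x 0 = x0" "x (Suc i) = lmm_step (x i) (gam i) (lam i) (v i)"
    "v i \<in> subdifferential h (F (x i))" "gam i > 0" for i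
    using lmm by (auto simp: lmm_subgradient_def)
  have g: "gam i = \<gamma> * ((h (F (x i)) - hstar) / (norm (range_proj (DF (x i)) (v i)))\<^sup>2)" for i
    using pol by (simp add: polyak_config_def)
  have \<gamma>: "0 < \<gamma>" "\<gamma> \<le> 1" "LF * \<gamma> \<le> Clb"
    using pol cap LF_nonneg
    by (auto simp: polyak_config_def polyak_cap_def field_simps split: if_splits)
  have a: "a i > 0" for i
    using lam[of i] by (auto simp: a_def)
  have step: "a (Suc i) \<le> r * a i" if "a i \<le> a 0" for i
    using polyak_step[OF x(3) _ lam(1) lam(3)[unfolded a_def] lam(2)[unfolded a_def] Cub \<gamma> g x(4), of i]
      that near by (simp add: a_def r_def x)
  have "0 < r * a 0" using step[of 0] a[of 1] by simp
  then have r: "0 < r" using a[of 0] by (simp add: zero_less_mult_iff)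
  have r1: "r \<le> 1" using \<gamma> by (simp add: r_def)
  have "a i \<le> r ^ i * a 0" for i
  proof (induction i)
    case (Suc i)
    have "r ^ i * a 0 \<le> 1 * a 0" using r r1 a[of 0] by (intro mult_right_mono power_le_one) auto
    with Suc have "a (Suc i) \<le> r * a i" by (intro step) simp
    also have "\<dots> \<le> r * (r ^ i * a 0)" using Suc r by (intro mult_left_mono) auto
    finally show ?case by simp
  qed simp
  then have "a k \<le> r ^ k * a 0" .
  also have "r ^ k = r powr real k" using r by (simp add: powr_realpow)
  also have "\<dots> * a 0 \<le> r powr (real k / 2) * a 0"
    using r r1 a[of 0] by (intro mult_right_mono powr_mono') auto
  finally show ?thesis by (simp add: a_def r_def x)
qed

text \<open>The bound \<open>\<mu> \<le> 2 * L\<close> for the step from \<open>x k\<close> is read off at the next iterate: if that one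
  is mapped to \<open>zstar\<close>, there is nothing to prove, and otherwise \<open>mu_le\<close> applies to it.\<close>

theorem geometric_rate:
  defines "M \<equiv> \<delta> (\<mu> / (8 * L))"
  assumes lmm: "lmm_subgradient h F DF x0 (\<lambda>k. \<gamma> * q ^ k) (\<lambda>k. lam * q ^ k) v x"
    and pos: "0 < \<gamma>" "0 < lam" "0 < q"
    and lam: "lam \<le> M * s (\<mu> / (8 * L)) / 128 * (\<mu> / L)"
    and cap: "\<gamma> \<le> geometric_cap \<mu> L LF M lam"
    and q: "q \<ge> max (1 - \<gamma> * \<mu> / (4 * M)) (1 / sqrt 2)" "q < 1"
    and near: "norm (F x0 - zstar) \<le> M"
  shows "norm (F (x k) - zstar) \<le> M * q ^ k"
proof -
  have x: "x 0 = x0" "x (Suc i) = lmm_step (x i) (\<gamma> * q ^ i) (lam * q ^ i) (v i)"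
    "v i \<in> subdifferential h (F (x i))" for i
    using lmm by (auto simp: lmm_subgradient_def)
  have M: "M > 0" using aligned mu_pos L_pos by (simp add: weakly_aligned_def M_def)
  have \<gamma>1: "\<gamma> * L\<^sup>2 \<le> M * \<mu> / 64"
  proof -
    have "geometric_cap \<mu> L LF M lam \<le> 1 / L * (M * \<mu> / (64 * L))"
      unfolding geometric_cap_def using L_pos by (intro mult_left_mono) auto
    with cap have "\<gamma> \<le> 1 / L * (M * \<mu> / (64 * L))" by (rule order_trans)
    then show ?thesis using L_pos by (simp add: field_simps power2_eq_square)
  qed
  have \<gamma>2: "LF * \<gamma> * L\<^sup>2 \<le> lam * \<mu> / 2"
  proof (cases "LF = 0")
    case False
    then have LF: "LF > 0" using LF_nonneg by simp
    have "geometric_cap \<mu> L LF M lam \<le> 1 / L * (lam * \<mu> / (2 * LF * L))"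
      unfolding geometric_cap_def using L_pos False by (intro mult_left_mono) auto
    with cap have "\<gamma> \<le> 1 / L * (lam * \<mu> / (2 * LF * L))" by (rule order_trans)
    then show ?thesis using L_pos LF by (simp add: field_simps power2_eq_square)
  qed (use pos mu_pos in simp)
  have "7 / 10 \<le> 1 / sqrt 2"
  proof -
    have "sqrt 2 \<le> 10 / 7" by (rule real_le_lsqrt) (auto simp: power2_eq_square)
    then show ?thesis by (simp add: field_simps)
  qed
  then have q7: "7 / 10 \<le> q" using q(1) by simp
  have "M * (1 - \<gamma> * \<mu> / (4 * M)) \<le> M * q" using q(1) M by (intro mult_left_mono) auto
  moreover have "M * (1 - \<gamma> * \<mu> / (4 * M)) = M - \<gamma> * \<mu> / 4"
    using M by (simp add: right_diff_distrib)
  ultimately have qM: "M - \<gamma> * \<mu> / 4 \<le> M * q" by simp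
  show ?thesis
  proof (induction k)
    case 0
    then show ?case using near by (simp add: x)
  next
    case (Suc k)
    have qk: "0 < q ^ k" "q ^ k \<le> 1" using pos q(2) by (auto intro: power_le_one)
    show ?case
    proof (cases "F (x (Suc k)) = zstar")
      case True
      then show ?thesis using M pos by simp
    next
      case False
      have "norm (F (x (Suc k)) - zstar)
          \<le> max (7 / 10 * (M * q ^ k)) (M * q ^ k - \<gamma> * q ^ k * \<mu> / 4)"
        unfolding x(2)
      proof (rule geometric_step[OF x(3) Suc])
        show "M * q ^ k \<le> \<delta> (\<mu> / (8 * L))"
          using M qk unfolding M_def[symmetric] by (simp add: mult_left_le)
        show "\<mu> \<le> 2 * L" using mu_le[OF x(3) False] .
        show "lam * q ^ k \<le> M * q ^ k * s (\<mu> / (8 * L)) / 128 * (\<mu> / L)"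
          using mult_right_mono[OF lam, of "q ^ k"] qk by (simp add: mult_ac)
        show "\<gamma> * q ^ k * L\<^sup>2 \<le> M * q ^ k * \<mu> / 64"
          using mult_right_mono[OF \<gamma>1, of "q ^ k"] qk by (simp add: mult_ac)
        show "LF * (\<gamma> * q ^ k) * L\<^sup>2 \<le> lam * q ^ k * \<mu> / 2"
          using mult_right_mono[OF \<gamma>2, of "q ^ k"] qk by (simp add: mult_ac)
      qed (use M qk pos in auto)
      also have "\<dots> \<le> q * (M * q ^ k)"
      proof (rule max.boundedI)
        show "7 / 10 * (M * q ^ k) \<le> q * (M * q ^ k)"
          using q7 M qk by (intro mult_right_mono) auto
        show "M * q ^ k - \<gamma> * q ^ k * \<mu> / 4 \<le> q * (M * q ^ k)"
          using mult_right_mono[OF qM, of "q ^ k"] qk by (simp add: algebra_simps)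
      qed
      finally show ?thesis by (simp add: mult_ac)
    qed
  qed
qed

end

theorem theorem4p1:
  fixes h :: "'y::euclidean_space \<Rightarrow> real"
    and F :: "'e::euclidean_space \<Rightarrow> 'y"
    and DF :: "'e \<Rightarrow> 'e \<Rightarrow>\<^sub>L 'y"
    and \<sigma> :: "'e \<Rightarrow> nat \<Rightarrow> real"
    and U :: "'e \<Rightarrow> nat \<Rightarrow> 'y"
    and V :: "'e \<Rightarrow> nat \<Rightarrow> 'e"
    and \<mu> L LF :: real
    and \<delta> s :: "real \<Rightarrow> real"
    and zstar :: 'y
    and x0 :: 'e
  assumes "convex_on UNIV h"
    and "\<And>x. (F has_derivative blinfun_apply (DF x)) (at x)"
    and "continuous_on UNIV DF"
    and "\<And>x. is_svd (DF x) (\<sigma> x) (U x) (V x)"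
    and "LF-lipschitz_on UNIV DF"
    and "nonsmooth_regular h F DF \<mu> L zstar"
    and "weakly_aligned F \<sigma> U zstar \<delta> s"
    and "norm (F x0 - zstar) \<le> \<delta> (\<mu> / (8 * L))"
  shows
    "(\<forall>\<gamma> Clb Cub gam lam v x.
        lmm_subgradient h F DF x0 gam lam v x \<and>
        polyak_config h F DF \<gamma> Clb Cub gam lam v x \<and>
        \<gamma> \<le> polyak_cap Clb LF \<and>
        Cub \<le> \<mu> / (8 * L) * s (\<mu> / (8 * L))
        \<longrightarrow> (\<forall>k. norm (F (x k) - zstar)
                  \<le> (1 - \<gamma> * \<mu>\<^sup>2 / (8 * L\<^sup>2)) powr (real k / 2) * norm (F x0 - zstar)))
     \<and>
     (let M = \<delta> (\<mu> / (8 * L)) in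
      \<forall>\<gamma> lam q v x.
        0 < \<gamma> \<and> 0 < lam \<and> 0 < q \<and> q < 1 \<and>
        lmm_subgradient h F DF x0 (\<lambda>k. \<gamma> * q ^ k) (\<lambda>k. lam * q ^ k) v x \<and>
        lam \<le> M * s (\<mu> / (8 * L)) / 128 * (\<mu> / L) \<and>
        \<gamma> \<le> geometric_cap \<mu> L LF M lam \<and>
        q \<ge> max (1 - \<gamma> * \<mu> / (4 * M)) (1 / sqrt 2)
        \<longrightarrow> (\<forall>k. norm (F (x k) - zstar) \<le> M * q ^ k))"
proof -
  interpret aligned_composite h F DF \<sigma> U V \<mu> L LF \<delta> s zstar
    using assms(2,4-7) by unfold_locales
  show ?thesis
    unfolding Let_def using polyak_rate geometric_rate assms(8) by blast
qed

end
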